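(* Consider the problem of minimizing $f(x)$ subject to $Ax=b$, where $f:\mathbb{R}^n\to\mathbb{R}\cup\{+\infty\}$ is proper, lower semicontinuous and convex, $A\in\mathbb{R}^{m\times n}$ and $b\in\mathbb{R}^m$, and let $(x^\star,y^\star)$ be a saddle point of its Lagrangian $L(x,y)=f(x)+\langle Ax-b,y\rangle$. Let $p\ge1$, $\lambda>0$, $c\ge0$ and $\varepsilon_k=\frac{c}{(k+1)^{p+1}}$. Put $A_k:=k^{p+1}$ for $k\ge0$ and $a_k:=A_k-A_{k-1}$ for $k\ge1$. Let $(x^k,y^k)_{k\in\mathbb{N}_0}$ be generated by the inexact power augmented Lagrangian method with averaging (described in the context) with $\theta_k=\frac{A_k}{A_{k+1}}$ and termination criterion $$L(x^{k+1},y^{k+1})\le\inf_{x\in\mathbb{R}^n}L(x,y^{k+1})+\varepsilon_k\qquad\text{for all }k\in\mathbb{N}_0,$$ and let $\breve x^K:=\frac{\sum_{k=1}^Ka_kx^k}{\sum_{k=1}^Ka_k}$ be the ergodic primal iterates. Then for all $K\ge1$ $$\max\{\|A\breve x^K-b\|_*,\ |f(\breve x^K)-f(x^\star)|\}\le\frac{c+\max_{y\in\delta\mathcal{B}}(\lambda\star\phi)(y^0-y)\,(p+1)^{p+1}}{K^p},$$ where $\delta=2\|y^\star\|+1$ and $\mathcal{B}:=\{y\in\mathbb{R}^m:\|y\|\le1\}$ is the closed unit ball.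
   Context: $\|\cdot\|$ denotes $\|\cdot\|_r$ on $\mathbb{R}^m$, where either $r=2$ or $r=p+1$, and $\|\cdot\|_*$ is its dual norm. $\phi:=\frac1{p+1}\|\cdot\|^{p+1}$, with convex conjugate $\phi^*=\frac1{q+1}\|\cdot\|_*^{q+1}$, where $\frac1{p+1}+\frac1{q+1}=1$. The epi-scaling is $(\lambda\star\phi)(x)=\lambda\phi(\lambda^{-1}x)=\lambda^{-p}\frac1{p+1}\|x\|^{p+1}$. Standing assumption: strong duality $\sup_y\inf_xL(x,y)=\inf\{f(x):Ax=b\}$ holds and primal and dual solutions exist. A saddle point satisfies $L(x^\star,y)\le L(x^\star,y^\star)\le L(x,y^\star)$ for all $x\in\mathbb{R}^n$, $y\in\mathbb{R}^m$. The augmented Lagrangian is $L_\lambda(x,y)=f(x)+\langle y,Ax-b\rangle+\lambda\phi^*(Ax-b)$, so that $\nabla_yL_\lambda(x,y)=Ax-b$ for $x\in\operatorname{dom}f$. Inexact power augmented Lagrangian method with averaging: given $x^0\in\mathbb{R}^n$, $y^0\in\mathbb{R}^m$ and $\theta_k\in[0,1]$, for $k=0,1,\dots$ set $w^k=\theta_ky^k+(1-\theta_k)y^0$, choose $x^{k+1}\approx\operatorname{argmin}_xL_\lambda(x,w^k)$ (approximately, as quantified by the termination criterion in the claim), and set $$y^{k+1}=w^k+\lambda\nabla\phi^*(Ax^{k+1}-b).$$ *)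

theory Defs
  imports "HOL-Analysis.Analysis"
begin

definition lr_norm :: "real \<Rightarrow> real ^ 'm \<Rightarrow> real" where
  "lr_norm r y = (\<Sum>i\<in>UNIV. \<bar>y $ i\<bar> powr r) powr (1 / r)"

definition dual_norm :: "(real ^ 'm \<Rightarrow> real) \<Rightarrow> real ^ 'm \<Rightarrow> real" where
  "dual_norm N z = (SUP y\<in>{y. N y \<le> 1}. z \<bullet> y)"

(* The supremum is taken in the reals, so this is the convex conjugate only for those g whose
   conjugate is finite everywhere (superlinear growth, as for power_fun with p > 0). *)
definition convex_conjugate :: "(real ^ 'm \<Rightarrow> real) \<Rightarrow> real ^ 'm \<Rightarrow> real" where
  "convex_conjugate g z = (SUP y. z \<bullet> y - g y)"

definition power_fun :: "real \<Rightarrow> real \<Rightarrow> real ^ 'm \<Rightarrow> real" where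
  "power_fun p r y = 1 / (p + 1) * lr_norm r y powr (p + 1)"

definition epi_scale :: "real \<Rightarrow> (real ^ 'm \<Rightarrow> real) \<Rightarrow> real ^ 'm \<Rightarrow> real" where
  "epi_scale lam g y = lam * g (inverse lam *\<^sub>R y)"

definition gradient :: "(real ^ 'm \<Rightarrow> real) \<Rightarrow> real ^ 'm \<Rightarrow> real ^ 'm" where
  "gradient g z = (THE D. GDERIV g z :> D)"

definition proper_fun :: "(real ^ 'n \<Rightarrow> ereal) \<Rightarrow> bool" where
  "proper_fun f \<longleftrightarrow> (\<forall>x. f x \<noteq> - \<infinity>) \<and> (\<exists>x. f x \<noteq> \<infinity>)"

definition lsc_fun :: "(real ^ 'n \<Rightarrow> ereal) \<Rightarrow> bool" where
  "lsc_fun f \<longleftrightarrow> (\<forall>x. f x \<le> Liminf (at x) f)"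

(* Restricting to 0 < t < 1 avoids products of 0 and infinity. *)
definition convex_fun :: "(real ^ 'n \<Rightarrow> ereal) \<Rightarrow> bool" where
  "convex_fun f \<longleftrightarrow> (\<forall>x y. \<forall>t\<in>{0<..<1}.
     f (t *\<^sub>R x + (1 - t) *\<^sub>R y) \<le> ereal t * f x + ereal (1 - t) * f y)"

definition lagrangian ::
  "(real ^ 'n \<Rightarrow> ereal) \<Rightarrow> real ^ 'n ^ 'm \<Rightarrow> real ^ 'm \<Rightarrow> real ^ 'n \<Rightarrow> real ^ 'm \<Rightarrow> ereal" where
  "lagrangian f A b x y = f x + ereal ((A *v x - b) \<bullet> y)"

definition saddle_point ::
  "(real ^ 'n \<Rightarrow> real ^ 'm \<Rightarrow> ereal) \<Rightarrow> real ^ 'n \<Rightarrow> real ^ 'm \<Rightarrow> bool" where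
  "saddle_point L xs ys \<longleftrightarrow> (\<forall>x y. L xs y \<le> L xs ys \<and> L xs ys \<le> L x ys)"

definition primal_value :: "(real ^ 'n \<Rightarrow> ereal) \<Rightarrow> real ^ 'n ^ 'm \<Rightarrow> real ^ 'm \<Rightarrow> ereal" where
  "primal_value f A b = (INF x\<in>{x. A *v x = b}. f x)"

definition dual_fun ::
  "(real ^ 'n \<Rightarrow> ereal) \<Rightarrow> real ^ 'n ^ 'm \<Rightarrow> real ^ 'm \<Rightarrow> real ^ 'm \<Rightarrow> ereal" where
  "dual_fun f A b y = (INF x. lagrangian f A b x y)"

definition strong_duality :: "(real ^ 'n \<Rightarrow> ereal) \<Rightarrow> real ^ 'n ^ 'm \<Rightarrow> real ^ 'm \<Rightarrow> bool" where
  "strong_duality f A b \<longleftrightarrow> (SUP y. dual_fun f A b y) = primal_value f A b"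

definition primal_solution ::
  "(real ^ 'n \<Rightarrow> ereal) \<Rightarrow> real ^ 'n ^ 'm \<Rightarrow> real ^ 'm \<Rightarrow> real ^ 'n \<Rightarrow> bool" where
  "primal_solution f A b x \<longleftrightarrow> A *v x = b \<and> f x = primal_value f A b"

definition dual_solution ::
  "(real ^ 'n \<Rightarrow> ereal) \<Rightarrow> real ^ 'n ^ 'm \<Rightarrow> real ^ 'm \<Rightarrow> real ^ 'm \<Rightarrow> bool" where
  "dual_solution f A b y \<longleftrightarrow> dual_fun f A b y = (SUP y'. dual_fun f A b y')"

definition averaged_point :: "(nat \<Rightarrow> real) \<Rightarrow> (nat \<Rightarrow> real ^ 'm) \<Rightarrow> nat \<Rightarrow> real ^ 'm" where
  "averaged_point th y k = th k *\<^sub>R y k + (1 - th k) *\<^sub>R y 0"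

(* Dual half of the method. The inexact primal step, approximate minimisation over x of
   lagrangian f A b x w + lam * convex_conjugate (power_fun p r) (A x - b) at the averaged
   point w, is quantified solely by a termination criterion on L (x (k+1)) (y (k+1)), so it
   contributes no condition here. *)
definition power_alm_avg_dual_update ::
  "real ^ 'n ^ 'm \<Rightarrow> real ^ 'm \<Rightarrow> real \<Rightarrow> real \<Rightarrow> real \<Rightarrow> (nat \<Rightarrow> real) \<Rightarrow>
   (nat \<Rightarrow> real ^ 'n) \<Rightarrow> (nat \<Rightarrow> real ^ 'm) \<Rightarrow> bool" where
  "power_alm_avg_dual_update A b p r lam th x y \<longleftrightarrow>
     (\<forall>k. y (Suc k) = averaged_point th y k
        + lam *\<^sub>R gradient (convex_conjugate (power_fun p r)) (A *v x (Suc k) - b))"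

definition weight :: "real \<Rightarrow> nat \<Rightarrow> real" where
  "weight p k = real k powr (p + 1)"

definition weight_diff :: "real \<Rightarrow> nat \<Rightarrow> real" where
  "weight_diff p k = weight p k - weight p (k - 1)"

definition ergodic_iterate :: "real \<Rightarrow> (nat \<Rightarrow> real ^ 'n) \<Rightarrow> nat \<Rightarrow> real ^ 'n" where
  "ergodic_iterate p x K =
     (1 / (\<Sum>k=1..K. weight_diff p k)) *\<^sub>R (\<Sum>k=1..K. weight_diff p k *\<^sub>R x k)"

end

theory Submission
  imports Defs
begin

text \<open>
  Each iteration is a proximal step on the dual function \<open>d\<close>, which is bounded above by \<open>f xs\<close>.
  Let \<open>L\<close> be the Lagrangian and \<open>\<psi>\<close> the epi-scaled power function. The gradient of the conjugate at
  the residual \<open>A x - b\<close> is a maximizer of the linear function with that slope minus the power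
  function (\<open>power_fun_maximizer\<close>); hence \<open>y (k+1)\<close> maximizes \<open>v \<mapsto> L (x (k+1)) v - \<psi> (v - w)\<close>,
  where \<open>w\<close> is the averaged point. Comparing with \<open>v = \<theta> y k + (1 - \<theta>) u\<close>, and using the termination
  criterion, gives for every \<open>u\<close>

  \<open>\<theta> d (y k) + (1 - \<theta>) L (x (k+1)) u \<le> d (y (k+1)) + \<epsilon> + (1 - \<theta>) powr (p+1) * \<psi> (u - y 0)\<close>.

  The averaging with the starting point is what makes the last term depend on \<open>u - y 0\<close> alone
  (\<open>averaged_proximal_step\<close>). Multiplied by the weight \<open>(k+1) powr (p+1)\<close>, the dual values telescope,
  the accuracy contributes \<open>c\<close>, and by Bernoulli's inequality \<open>1 - \<theta> \<le> (p+1) / (k+1)\<close> the penalty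
  contributes at most \<open>(p+1) powr (p+1) * \<psi> (u - y 0)\<close>. Summing \<open>K\<close> steps and dividing by
  \<open>K powr (p+1)\<close> leaves an error of order \<open>1 / K powr p\<close> (\<open>ergodic_potential_bound\<close>).

  Since \<open>f\<close> is convex, \<open>L\<close> at the ergodic iterate is bounded by the average of its values at the
  iterates (\<open>ergodic_iterate_jensen\<close>). The resulting estimate holds for all \<open>u\<close> in a ball whose radius
  exceeds twice the norm of the multiplier \<open>ys\<close>. Maximizing over that ball produces the dual norm of
  the residual, and the saddle inequality controls the sign of the gap; together they bound the
  residual and the gap separately (\<open>residual_and_gap_bound\<close>).
\<close>

section \<open>Scalar Young inequality and the power duality map\<close>

text \<open>
  In an inner product space, and for \<open>q > 0\<close>, this is the gradient of
  \<open>z \<mapsto> norm z powr (q + 1) / (q + 1)\<close>. Writing it with \<^const>\<open>sgn\<close> gives the value \<open>0\<close> at \<open>0\<close>,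
  and for real \<open>z\<close> it is the familiar \<open>sgn z * \<bar>z\<bar> powr q\<close>, so that one definition serves
  both for the Euclidean norm and, coordinate by coordinate, for the norm with exponent \<open>p + 1\<close>.
\<close>

definition power_duality_map :: "real \<Rightarrow> 'a::real_normed_vector \<Rightarrow> 'a" where
  "power_duality_map q z = norm z powr q *\<^sub>R sgn z"

lemma young_powr_conjugate:
  fixes s t p :: real
  assumes "p > 0" "s \<ge> 0" "t \<ge> 0"
  shows "s * t \<le> t powr (p + 1) / (p + 1) + p / (p + 1) * s powr (1 / p + 1)"
proof -
  have "t * s \<le> t powr (p + 1) / (p + 1) + s powr (1 / p + 1) / (1 / p + 1)"
    using assms by (intro Youngs_inequality) (auto simp: field_simps)
  moreover have "s powr (1 / p + 1) / (1 / p + 1) = p / (p + 1) * s powr (1 / p + 1)"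
    using assms by (simp add: field_simps)
  ultimately show ?thesis by (simp add: mult.commute)
qed

lemma norm_power_duality_map: "norm (power_duality_map q z) = norm z powr q"
  by (cases "z = 0") (auto simp: power_duality_map_def norm_sgn)

lemma inner_power_duality_map:
  fixes z :: "'a::real_inner"
  shows "z \<bullet> power_duality_map q z = norm z powr (q + 1)"
  by (cases "z = 0")
    (auto simp: power_duality_map_def sgn_div_norm powr_add dot_square_norm power2_eq_square)

text \<open>
  Cauchy--Schwarz reduces the claim to the scalar Young inequality for \<open>norm z\<close> and \<open>norm v\<close>; both
  inequalities are equalities at the image of \<open>z\<close> under the duality map with exponent \<open>1 / p\<close>.
\<close>

lemma power_duality_map_maximizes:
  fixes z v :: "'a::real_inner"
  assumes "p > 0"
  shows "z \<bullet> v - norm v powr (p + 1) / (p + 1)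
       \<le> z \<bullet> power_duality_map (1 / p) z - norm (power_duality_map (1 / p) z) powr (p + 1) / (p + 1)"
proof -
  have "z \<bullet> v \<le> norm z * norm v" by (rule norm_cauchy_schwarz)
  also have "\<dots> \<le> norm v powr (p + 1) / (p + 1) + p / (p + 1) * norm z powr (1 / p + 1)"
    using assms by (intro young_powr_conjugate) auto
  also have "p / (p + 1) * norm z powr (1 / p + 1)
      = z \<bullet> power_duality_map (1 / p) z - norm (power_duality_map (1 / p) z) powr (p + 1) / (p + 1)"
  proof -
    have "(norm z powr (1 / p)) powr (p + 1) = norm z powr (1 / p + 1)"
      using assms by (simp add: powr_powr field_simps)
    then show ?thesis
      using assms by (simp add: inner_power_duality_map norm_power_duality_map field_simps)
  qed
  finally show ?thesis by simp
qed

text \<open>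
  Away from \<open>0\<close> the defining formula is continuous as written. At \<open>0\<close>, where \<^const>\<open>sgn\<close> jumps,
  the norm of the map is \<open>norm z powr q\<close>, which tends to \<open>0\<close>.
\<close>

lemma isCont_power_duality_map:
  fixes z :: "'a::real_normed_vector"
  assumes "q > 0"
  shows "isCont (power_duality_map q) z"
proof (cases "z = 0")
  case True
  have "((\<lambda>x::'a. norm x powr q) \<longlongrightarrow> 0 powr q) (at 0)"
    by (rule tendsto_powr') (use assms in \<open>auto intro!: tendsto_eq_intros\<close>)
  then have "((\<lambda>x. norm (power_duality_map q x)) \<longlongrightarrow> 0) (at (0::'a))"
    by (simp add: norm_power_duality_map)
  then have "(power_duality_map q \<longlongrightarrow> 0) (at (0::'a))"
    by (rule tendsto_norm_zero_cancel)
  moreover have "power_duality_map q (0::'a) = 0"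
    by (simp add: power_duality_map_def)
  ultimately show ?thesis
    by (simp add: True isCont_def)
next
  case False
  then show ?thesis
    unfolding power_duality_map_def sgn_div_norm using assms
    by (auto intro!: continuous_intros)
qed

section \<open>Gradients of convex conjugates\<close>

lemma convex_conjugate_eqI:
  fixes z w :: "real ^ 'm"
  assumes "\<And>v. z \<bullet> v - \<phi> v \<le> z \<bullet> w - \<phi> w"
  shows "convex_conjugate \<phi> z = z \<bullet> w - \<phi> w"
  unfolding convex_conjugate_def using assms by (intro cSup_eq_maximum) auto

text \<open>
  A continuous selection \<open>g\<close> of maximizers in the definition of the conjugate is its gradient
  (an envelope theorem). Testing the supremum at \<open>y\<close> with \<open>g z\<close>, and the one at \<open>z\<close> with \<open>g y\<close>,
  traps the linearization error between \<open>0\<close> and \<open>(y - z) \<bullet> (g y - g z)\<close>, which is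
  \<open>o(norm (y - z))\<close> by continuity.
\<close>

lemma gradient_convex_conjugate:
  fixes \<phi> :: "real ^ 'm \<Rightarrow> real"
  assumes max: "\<And>z v. z \<bullet> v - \<phi> v \<le> z \<bullet> g z - \<phi> (g z)"
    and cont: "isCont g z"
  shows "gradient (convex_conjugate \<phi>) z = g z"
proof -
  let ?c = "convex_conjugate \<phi>"
  have conj: "?c z = z \<bullet> g z - \<phi> (g z)" for z
    by (rule convex_conjugate_eqI) (rule max)
  have bound: "\<bar>?c y - ?c z - (y - z) \<bullet> g z\<bar> \<le> norm (y - z) * norm (g y - g z)" for y
  proof -
    have "0 \<le> ?c y - ?c z - (y - z) \<bullet> g z"
      using max[of y "g z"] by (simp add: conj inner_diff_left)
    moreover have "?c y - ?c z - (y - z) \<bullet> g z \<le> (y - z) \<bullet> (g y - g z)"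
      using max[of z "g y"] by (simp add: conj inner_diff_left inner_diff_right)
    moreover have "(y - z) \<bullet> (g y - g z) \<le> norm (y - z) * norm (g y - g z)"
      by (rule norm_cauchy_schwarz)
    ultimately show ?thesis by linarith
  qed
  have "GDERIV ?c z :> g z"
    unfolding gderiv_def
  proof (rule has_derivativeI_sandwich[where e = 1 and H = "\<lambda>y. norm (g y - g z)"])
    show "((\<lambda>y. norm (g y - g z)) \<longlongrightarrow> 0) (at z)"
      using cont by (simp add: isCont_def LIM_zero tendsto_norm_zero)
    show "norm ((?c y - ?c z) - (y - z) \<bullet> g z) / norm (y - z) \<le> norm (g y - g z)"
      if "y \<noteq> z" for y
      using bound[of y] that by (simp add: divide_le_eq mult.commute)
  qed (auto intro: bounded_linear_intros)
  moreover have "D = g z" if "GDERIV ?c z :> D" for D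
  proof -
    have "(\<lambda>h. h \<bullet> D) = (\<lambda>h. h \<bullet> g z)"
      using that calculation unfolding gderiv_def by (rule has_derivative_unique)
    then have "h \<bullet> D = h \<bullet> g z" for h by (rule fun_cong)
    then show ?thesis by (metis vector_eq_ldot)
  qed
  ultimately show ?thesis unfolding gradient_def by blast
qed

section \<open>The power function and its proximal term\<close>

lemma lr_norm_2: "lr_norm 2 y = norm (y :: real ^ 'm)"
  by (simp add: lr_norm_def norm_vec_def L2_set_def powr_half_sqrt sum_nonneg)

lemma lr_norm_nonneg [simp]: "lr_norm r y \<ge> 0"
  by (simp add: lr_norm_def)

lemma lr_norm_zero [simp]: "lr_norm r 0 = 0"
  by (simp add: lr_norm_def)

lemma lr_norm_scaleR:
  assumes "r > 0"
  shows "lr_norm r (t *\<^sub>R y) = \<bar>t\<bar> * lr_norm r y"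
proof -
  have "(\<Sum>i\<in>UNIV. \<bar>(t *\<^sub>R y) $ i\<bar> powr r) = \<bar>t\<bar> powr r * (\<Sum>i\<in>UNIV. \<bar>y $ i\<bar> powr r)"
    by (simp add: abs_mult powr_mult sum_distrib_left)
  then show ?thesis
    using assms by (simp add: lr_norm_def powr_mult sum_nonneg powr_powr)
qed

lemma lr_norm_powr: 
  assumes "r > 0" shows "lr_norm r y powr r = (\<Sum>i\<in>UNIV. \<bar>y $ i\<bar> powr r)"
  using assms by (simp add: lr_norm_def powr_powr sum_nonneg)

lemma abs_component_le_lr_norm:
  assumes "r > 0"
  shows "\<bar>y $ i\<bar> \<le> lr_norm r y"
proof -
  have "\<bar>y $ i\<bar> powr r \<le> lr_norm r y powr r"
    unfolding lr_norm_powr[OF assms] by (rule member_le_sum) auto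
  then show ?thesis
    using powr_less_mono2[OF assms lr_norm_nonneg] by (meson not_le)
qed

text \<open>
  The two admissible exponents \<open>r\<close> call for different selections of maximizers. For \<open>r = 2\<close> the
  duality map of the Euclidean space is the required continuous selection. For \<open>r = p + 1\<close> the
  power function is a sum of one-dimensional power functions, and the duality map of the
  real line is applied in each coordinate.
\<close>

lemma power_fun_maximizer:
  fixes z v :: "real ^ 'm"
  assumes "p \<ge> 1" "r = 2 \<or> r = p + 1"
  defines "\<phi> \<equiv> power_fun p r" 
  defines "w \<equiv> gradient (convex_conjugate \<phi>) z"
  shows "z \<bullet> v - \<phi> v \<le> z \<bullet> w - \<phi> w"
proof -
  obtain g :: "real ^ 'm \<Rightarrow> real ^ 'm" where
    g: "\<And>z v. z \<bullet> v - \<phi> v \<le> z \<bullet> g z - \<phi> (g z)" "\<And>z. isCont g z"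
  proof (cases "r = 2")
    case True
    show ?thesis
    proof (rule that[of "power_duality_map (1 / p)"])
      show "z \<bullet> v - \<phi> v \<le> z \<bullet> power_duality_map (1 / p) z - \<phi> (power_duality_map (1 / p) z)"
        for z v
        using power_duality_map_maximizes[of p z v] assms(1)
        by (simp add: \<phi>_def power_fun_def True lr_norm_2)
    qed (use assms(1) in \<open>auto intro: isCont_power_duality_map\<close>)
  next
    case False
    then have r: "r = p + 1" using assms(2) by simp
    have \<phi>: "\<phi> v = (\<Sum>i\<in>UNIV. norm (v $ i) powr (p + 1) / (p + 1))" for v
      using assms(1) lr_norm_powr[of r v]
      by (simp add: \<phi>_def power_fun_def r sum_divide_distrib)
    let ?g = "\<lambda>z :: real ^ 'm. \<chi> i. power_duality_map (1 / p) (z $ i)"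
    show ?thesis
    proof (rule that[of ?g])
      show "z \<bullet> v - \<phi> v \<le> z \<bullet> ?g z - \<phi> (?g z)" for z v
        unfolding \<phi> inner_vec_def sum_subtractf[symmetric] vec_lambda_beta
        using assms(1) by (intro sum_mono power_duality_map_maximizes) simp
      have cont: "isCont (\<lambda>z. power_duality_map (1 / p) (z $ i)) z" for z :: "real ^ 'm" and i
        using assms(1)
        by (intro isCont_o2[OF isCont_vec_nth isCont_power_duality_map] continuous_ident) auto
      show "isCont ?g z" for z
        unfolding isCont_def by (intro tendsto_vec_lambda cont[unfolded isCont_def])
    qed
  qed
  show ?thesis
    unfolding w_def gradient_convex_conjugate[of \<phi> g, OF g] by (rule g)
qed

lemma lr_norm_le_of_component_le:
  fixes v :: "real ^ 'm"
  assumes "r > 0" "\<And>i. \<bar>v $ i\<bar> \<le> M"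
  shows "lr_norm r v \<le> (\<Sum>i\<in>(UNIV :: 'm set). M powr r) powr (1 / r)"
  unfolding lr_norm_def using assms
  by (intro powr_mono2 sum_mono sum_nonneg) auto

text \<open>
  The maximum over the ball of dual points appears as a real supremum, so a member is below it
  only once the values are known to be bounded; a bound on all coordinates suffices.
\<close>

lemma bdd_above_power_fun:
  fixes y0 :: "real ^ 'm"
  assumes "p > 0" "r > 0" "lam > 0" "d \<ge> 0"
  shows "bdd_above ((\<lambda>v. epi_scale lam (power_fun p r) (y0 - v))
            ` ((\<lambda>u. d *\<^sub>R u) ` {u. lr_norm r u \<le> 1}))"
proof -
  define M where "M = inverse lam * (lr_norm r y0 + d)"
  define C where "C = (\<Sum>i\<in>(UNIV :: 'm set). M powr r) powr (1 / r)"
  have "epi_scale lam (power_fun p r) (y0 - d *\<^sub>R u) \<le> lam * (1 / (p + 1) * C powr (p + 1))"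
    if u: "lr_norm r u \<le> 1" for u
  proof -
    let ?v = "inverse lam *\<^sub>R (y0 - d *\<^sub>R u)"
    have "\<bar>?v $ i\<bar> \<le> M" for i
    proof -
      have "\<bar>y0 $ i - d * u $ i\<bar> \<le> \<bar>y0 $ i\<bar> + d * \<bar>u $ i\<bar>"
        using assms by (metis abs_mult abs_of_nonneg abs_triangle_ineq4)
      also have "\<dots> \<le> lr_norm r y0 + d * 1"
        using assms u abs_component_le_lr_norm[of r u i]
        by (intro add_mono mult_left_mono abs_component_le_lr_norm) auto
      finally show ?thesis
        using assms by (simp add: M_def abs_mult mult_left_mono)
    qed
    then have "lr_norm r ?v \<le> C"
      unfolding C_def by (rule lr_norm_le_of_component_le[OF \<open>r > 0\<close>])
    then show ?thesis
      using assms unfolding epi_scale_def power_fun_def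
      by (intro mult_left_mono powr_mono2) auto
  qed
  then show ?thesis by (intro bdd_aboveI2) auto
qed

lemma epi_scale_power_fun_scaleR:
  assumes "p > 0" "r > 0" "t \<ge> 0"
  shows "epi_scale lam (power_fun p r) (t *\<^sub>R v) = t powr (p + 1) * epi_scale lam (power_fun p r) v"
proof -
  have "inverse lam *\<^sub>R (t *\<^sub>R v) = t *\<^sub>R (inverse lam *\<^sub>R v)" by simp
  then show ?thesis
    using assms unfolding epi_scale_def power_fun_def
    by (simp only: lr_norm_scaleR) (simp add: powr_mult)
qed

lemma epi_scale_power_fun_minus_commute:
  assumes "r > 0"
  shows "epi_scale lam (power_fun p r) (u - v) = epi_scale lam (power_fun p r) (v - u)"
proof -
  have "inverse lam *\<^sub>R (u - v) = (- 1) *\<^sub>R (inverse lam *\<^sub>R (v - u))" by (simp add: algebra_simps)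
  then show ?thesis
    using assms unfolding epi_scale_def power_fun_def by (simp only: lr_norm_scaleR) simp
qed

lemma epi_scale_power_fun_nonneg:
  assumes "p > 0" "lam > 0"
  shows "epi_scale lam (power_fun p r) v \<ge> 0"
  using assms by (simp add: epi_scale_def power_fun_def)

text \<open>
  The dual update is a proximal step: the increment \<open>w\<close> that it adds to the averaged point
  maximizes the linear function given by the residual \<open>z\<close> minus the penalty \<open>\<psi>\<close>.
\<close>

lemma epi_scale_maximizer:
  fixes z v :: "real ^ 'm"
  assumes "p \<ge> 1" "r = 2 \<or> r = p + 1" "lam > 0"
  defines "\<psi> \<equiv> epi_scale lam (power_fun p r)"
  defines "w \<equiv> lam *\<^sub>R gradient (convex_conjugate (power_fun p r)) z"
  shows "z \<bullet> v - \<psi> v \<le> z \<bullet> w - \<psi> w"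
proof -
  have eq: "z \<bullet> v - \<psi> v = lam * (z \<bullet> (inverse lam *\<^sub>R v) - power_fun p r (inverse lam *\<^sub>R v))" for v
    using assms(3) by (simp add: \<psi>_def epi_scale_def right_diff_distrib)
  show ?thesis
    unfolding eq using assms(3) power_fun_maximizer[OF assms(1,2), of z "inverse lam *\<^sub>R v"]
    by (intro mult_left_mono) (simp_all add: w_def)
qed

section \<open>The dual norm and the choice of the dual radius\<close>

lemma bdd_above_dual_norm:
  fixes z :: "real ^ 'm"
  assumes "r > 0"
  shows "bdd_above ((\<lambda>u. z \<bullet> u) ` {u. lr_norm r u \<le> 1})"
proof (rule bdd_aboveI2)
  fix u :: "real ^ 'm" assume "u \<in> {u. lr_norm r u \<le> 1}"
  then have u: "\<bar>u $ i\<bar> \<le> 1" for i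
    using abs_component_le_lr_norm[OF assms, of u i] by simp
  have "z $ i * u $ i \<le> \<bar>z $ i\<bar>" for i
    using mult_left_mono[OF u, of "\<bar>z $ i\<bar>" i] abs_ge_self[of "z $ i * u $ i"]
    by (simp add: abs_mult)
  then show "z \<bullet> u \<le> (\<Sum>i\<in>UNIV. \<bar>z $ i\<bar>)"
    by (simp add: inner_vec_def sum_mono)
qed

lemma inner_le_dual_norm:
  fixes z u :: "real ^ 'm"
  assumes "r > 0"
  shows "z \<bullet> u \<le> lr_norm r u * dual_norm (lr_norm r) z"
proof (cases "lr_norm r u = 0")
  case True
  then have "u = 0"
    using abs_component_le_lr_norm[OF assms, of u] by (simp add: vec_eq_iff)
  then show ?thesis by simp
next
  case False
  then have pos: "lr_norm r u > 0"
    using lr_norm_nonneg[of r u] by linarith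
  have "z \<bullet> (inverse (lr_norm r u) *\<^sub>R u) \<le> dual_norm (lr_norm r) z"
    unfolding dual_norm_def using pos
    by (intro cSUP_upper bdd_above_dual_norm assms) (simp add: lr_norm_scaleR[OF assms])
  then show ?thesis
    using pos by (simp add: field_simps)
qed

lemma dual_norm_nonneg:
  assumes "r > 0"
  shows "dual_norm (lr_norm r) z \<ge> 0"
proof -
  have "z \<bullet> 0 \<le> dual_norm (lr_norm r) z"
    unfolding dual_norm_def by (intro cSUP_upper bdd_above_dual_norm assms) simp
  then show ?thesis by simp
qed

lemma dual_norm_leI:
  fixes z :: "real ^ 'm"
  assumes "d > 0" "\<And>u. lr_norm r u \<le> 1 \<Longrightarrow> d * (z \<bullet> u) \<le> T"
  shows "d * dual_norm (lr_norm r) z \<le> T"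
proof -
  have "dual_norm (lr_norm r) z \<le> T / d"
    unfolding dual_norm_def
  proof (rule cSUP_least)
    show "{u :: real ^ 'm. lr_norm r u \<le> 1} \<noteq> {}"
      by (auto intro: exI[of _ 0])
    show "z \<bullet> u \<le> T / d" if "u \<in> {u. lr_norm r u \<le> 1}" for u
      using assms that by (simp add: field_simps)
  qed
  then show ?thesis using assms(1) by (simp add: field_simps)
qed

text \<open>
  How a bound uniform in the dual variable yields feasibility and optimality. With
  \<open>N = lr_norm r ys\<close> and \<open>Z\<close> the dual norm of the residual \<open>z\<close>, the supremum over the ball of radius
  \<open>2 * N + 1\<close> gives \<open>g + (2 * N + 1) * Z \<le> R\<close>, while the saddle inequality gives \<open>g \<ge> - N * Z\<close>.
  One copy of \<open>N\<close> in the radius absorbs a negative gap and leaves \<open>Z \<le> R\<close>; the other makes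
  \<open>N * Z \<le> R\<close> and hence also bounds the gap from below.
\<close>

lemma residual_and_gap_bound:
  fixes z ys :: "real ^ 'm" and g R :: real
  assumes "r > 0"
    and saddle: "0 \<le> g + z \<bullet> ys"
    and upper: "\<And>u. lr_norm r u \<le> 1 \<Longrightarrow> g + (2 * lr_norm r ys + 1) * (z \<bullet> u) \<le> R"
  shows "dual_norm (lr_norm r) z \<le> R" "\<bar>g\<bar> \<le> R"
proof -
  define N Z where "N = lr_norm r ys" and "Z = dual_norm (lr_norm r) z"
  have N: "N \<ge> 0" and Z: "Z \<ge> 0" and NZ: "N * Z \<ge> 0"
    using dual_norm_nonneg[OF \<open>r > 0\<close>, of z] by (simp_all add: N_def Z_def)
  have "(2 * N + 1) * Z \<le> R - g"
    unfolding Z_def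
  proof (rule dual_norm_leI)
    show "0 < 2 * N + 1" using N by linarith
    show "(2 * N + 1) * (z \<bullet> u) \<le> R - g" if "lr_norm r u \<le> 1" for u
      using upper[OF that] by (simp add: N_def)
  qed
  then have 1: "g + 2 * (N * Z) + Z \<le> R" by (simp add: algebra_simps)
  have 2: "- g \<le> N * Z"
    using saddle inner_le_dual_norm[OF \<open>r > 0\<close>, of z ys] by (simp add: N_def Z_def)
  show "dual_norm (lr_norm r) z \<le> R" "\<bar>g\<bar> \<le> R"
    using 1 2 Z NZ unfolding Z_def[symmetric] by linarith+
qed

section \<open>The potential argument\<close>

text \<open>
  The proximal inequality is tested at the point \<open>th *\<^sub>R y + (1 - th) *\<^sub>R u\<close>. Since the averaged
  point \<open>w\<close> has the same form with \<open>y0\<close> in place of \<open>u\<close>, the difference is \<open>(1 - th) *\<^sub>R (u - y0)\<close>: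
  the old iterate cancels, and the penalty involves only the fixed distance from \<open>u\<close> to the starting
  point, reduced by the factor \<open>1 - th\<close>. Affinity of the Lagrangian in the dual variable splits
  the left-hand side. In the first step of the iteration \<open>th = 0\<close> and the value \<open>D\<close> at the starting
  point may be infinite, which is why \<open>dual\<close> carries the factor \<open>th\<close>.
\<close>

lemma averaged_proximal_step:
  fixes y y' y0 u z :: "real ^ 'm" and D D' F e th :: real
  defines "w \<equiv> th *\<^sub>R y + (1 - th) *\<^sub>R y0"
  assumes max: "\<And>v. z \<bullet> v - \<psi> v \<le> z \<bullet> (y' - w) - \<psi> (y' - w)"
    and nonneg: "\<psi> (y' - w) \<ge> 0"
    and crit: "F + z \<bullet> y' \<le> D' + e"
    and dual: "th * D \<le> th * (F + z \<bullet> y)"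
  shows "th * D + (1 - th) * (F + z \<bullet> u) \<le> D' + e + \<psi> ((1 - th) *\<^sub>R (u - y0))"
proof -
  let ?v = "th *\<^sub>R y + (1 - th) *\<^sub>R u"
  have "?v - w = (1 - th) *\<^sub>R (u - y0)"
    by (simp add: w_def algebra_simps)
  then have "z \<bullet> ?v - z \<bullet> w - \<psi> ((1 - th) *\<^sub>R (u - y0)) \<le> z \<bullet> y' - z \<bullet> w - \<psi> (y' - w)"
    using max[of "?v - w"] by (simp only: inner_diff_right[of z y' w] flip: inner_diff_right[of z ?v w])
  with nonneg have "z \<bullet> ?v \<le> z \<bullet> y' + \<psi> ((1 - th) *\<^sub>R (u - y0))"
    by linarith
  moreover have "th * (F + z \<bullet> y) + (1 - th) * (F + z \<bullet> u) = F + z \<bullet> ?v"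
    by (simp add: algebra_simps)
  ultimately show ?thesis using crit dual by linarith
qed

lemma weight_Suc_pos: "weight p (Suc k) > 0"
  by (simp add: weight_def)

lemma weight_0: "weight p 0 = 0"
  by (simp add: weight_def)

lemma weight_le_weight_Suc: "p > 0 \<Longrightarrow> weight p k \<le> weight p (Suc k)"
  by (simp add: weight_def powr_mono2)

lemma sum_weight_diff: "(\<Sum>k=1..K. weight_diff p k) = weight p K"
  by (induction K) (simp_all add: weight_diff_def weight_0)

text \<open>
  With \<open>t = k / (k + 1)\<close> this is Bernoulli's inequality \<open>1 - t powr (p + 1) \<le> (p + 1) * (1 - t)\<close>,
  which is the scalar Young inequality with one factor equal to \<open>1\<close>.
\<close>

lemma bernoulli_weight_ratio:
  assumes "p > 0"
  shows "1 - weight p k / weight p (Suc k) \<le> (p + 1) / real (Suc k)"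
proof -
  define t where "t = real k / real (Suc k)"
  have "weight p k / weight p (Suc k) = t powr (p + 1)"
    by (simp add: weight_def t_def powr_divide)
  moreover have "t \<le> (t powr (p + 1) + p) / (p + 1)"
    using young_powr_conjugate[of p 1 t] assms by (simp add: t_def add_divide_distrib)
  then have "1 - t powr (p + 1) \<le> (p + 1) * (1 - t)"
    using assms by (simp add: le_divide_eq algebra_simps)
  moreover have "1 - t = 1 / real (Suc k)" by (simp add: t_def field_simps)
  ultimately show ?thesis by simp
qed

text \<open>
  This is why the weights are \<open>k powr (p + 1)\<close>: the penalty of the step, multiplied by its
  weight, is then bounded independently of \<open>k\<close>.
\<close>

lemma weighted_prox_cost_le:
  assumes "p > 0"
  shows "weight p (Suc k) * (1 - weight p k / weight p (Suc k)) powr (p + 1) \<le> (p + 1) powr (p + 1)"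
proof -
  let ?s = "1 - weight p k / weight p (Suc k)"
  have "?s \<ge> 0"
    using weight_le_weight_Suc[OF assms, of k] weight_Suc_pos[of p k] by (simp add: divide_le_eq)
  then have "?s powr (p + 1) \<le> ((p + 1) / real (Suc k)) powr (p + 1)"
    using assms bernoulli_weight_ratio[OF assms] by (intro powr_mono2) auto
  also have "\<dots> = (p + 1) powr (p + 1) / weight p (Suc k)"
    using assms by (simp add: weight_def powr_divide)
  finally show ?thesis
    using weight_Suc_pos[of p k] by (simp add: field_simps)
qed

text \<open>
  Multiplying the inequality of one step by the weight of the new index makes the dual values
  telescope, because the weight of the new index times the averaging parameter is the previous
  weight. The accuracy \<open>c / weight p (Suc k)\<close> becomes the constant \<open>c\<close>, and the penalty is bounded
  by a constant as well, so the total error grows only linearly in \<open>K\<close>. Here \<open>z\<close> stands for the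
  residuals, \<open>F\<close> for the objective values and \<open>D\<close> for the values of the dual function.
\<close>

lemma ergodic_potential_bound:
  fixes y :: "nat \<Rightarrow> real ^ 'm" and z :: "nat \<Rightarrow> real ^ 'm" and F D :: "nat \<Rightarrow> real" and u :: "real ^ 'm"
  assumes "p \<ge> 1" "r = 2 \<or> r = p + 1" "lam > 0"
    and update: "\<And>k. y (Suc k) = averaged_point (\<lambda>k. weight p k / weight p (Suc k)) y k
        + lam *\<^sub>R gradient (convex_conjugate (power_fun p r)) (z (Suc k))"
    and crit: "\<And>k. F (Suc k) + z (Suc k) \<bullet> y (Suc k) \<le> D (Suc k) + c / weight p (Suc k)"
    and dual: "\<And>k j. D (Suc k) \<le> F (Suc j) + z (Suc j) \<bullet> y (Suc k)"
  shows "(\<Sum>k=1..K. weight_diff p k * (F k + z k \<bullet> u))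
       \<le> weight p K * D K
         + real K * (c + epi_scale lam (power_fun p r) (u - y 0) * (p + 1) powr (p + 1))"
    (is "_ \<le> _ + _ * ?C")
proof (induction K)
  case 0
  then show ?case by (simp add: weight_0)
next
  case (Suc K)
  let ?\<psi> = "epi_scale lam (power_fun p r)"
  define th where "th = weight p K / weight p (Suc K)"
  define a where "a = weight p (Suc K)"
  have pos: "p > 0" "r > 0" "a > 0" using assms(1,2) by (auto simp: a_def weight_Suc_pos)
  have th: "th \<le> 1" "a * th = weight p K"
    using weight_le_weight_Suc[OF pos(1), of K] weight_Suc_pos[of p K]
    by (auto simp: th_def a_def divide_le_eq)
  have diff: "weight_diff p (Suc K) = a * (1 - th)"
    using th(2) by (simp add: weight_diff_def a_def[symmetric] algebra_simps)
  have "th * D K + (1 - th) * (F (Suc K) + z (Suc K) \<bullet> u)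
      \<le> D (Suc K) + c / a + ?\<psi> ((1 - th) *\<^sub>R (u - y 0))"
  proof (rule averaged_proximal_step)
    let ?w = "th *\<^sub>R y K + (1 - th) *\<^sub>R y 0"
    have w: "y (Suc K) - ?w = lam *\<^sub>R gradient (convex_conjugate (power_fun p r)) (z (Suc K))"
      by (simp add: update averaged_point_def th_def)
    show "z (Suc K) \<bullet> v - ?\<psi> v \<le> z (Suc K) \<bullet> (y (Suc K) - ?w) - ?\<psi> (y (Suc K) - ?w)" for v
      unfolding w by (rule epi_scale_maximizer[OF assms(1-3)])
    show "?\<psi> (y (Suc K) - ?w) \<ge> 0"
      by (rule epi_scale_power_fun_nonneg[OF pos(1) assms(3)])
    show "F (Suc K) + z (Suc K) \<bullet> y (Suc K) \<le> D (Suc K) + c / a"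
      using crit by (simp add: a_def)
    show "th * D K \<le> th * (F (Suc K) + z (Suc K) \<bullet> y K)"
    proof (cases K)
      case 0
      then show ?thesis by (simp add: th_def weight_0)
    next
      case (Suc k)
      then show ?thesis
        using dual[of k K] pos(3) by (intro mult_left_mono) (auto simp: th_def weight_def)
    qed
  qed
  from mult_left_mono[OF this, of a]
  have "weight p K * D K + weight_diff p (Suc K) * (F (Suc K) + z (Suc K) \<bullet> u)
      \<le> a * D (Suc K) + c + a * ?\<psi> ((1 - th) *\<^sub>R (u - y 0))"
    using pos(3) by (simp add: diff th(2)[symmetric] algebra_simps)
  moreover have "a * ?\<psi> ((1 - th) *\<^sub>R (u - y 0)) \<le> ?\<psi> (u - y 0) * (p + 1) powr (p + 1)"
  proof -
    have "a * ?\<psi> ((1 - th) *\<^sub>R (u - y 0)) = ?\<psi> (u - y 0) * (a * (1 - th) powr (p + 1))"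
      using pos th by (simp add: epi_scale_power_fun_scaleR)
    also have "\<dots> \<le> ?\<psi> (u - y 0) * (p + 1) powr (p + 1)"
      unfolding a_def th_def
      by (intro mult_left_mono weighted_prox_cost_le epi_scale_power_fun_nonneg pos(1) assms(3))
    finally show ?thesis .
  qed
  ultimately show ?case
    using Suc.IH by (simp add: a_def algebra_simps)
qed

section \<open>Ergodic iterates and the saddle point\<close>

lemma convex_fun_real_of_ereal:
  fixes f :: "real ^ 'n \<Rightarrow> ereal"
  assumes "proper_fun f" "convex_fun f"
  shows "convex_on {x. f x \<noteq> \<infinity>} (\<lambda>x. real_of_ereal (f x))"
proof -
  have minf: "f x \<noteq> - \<infinity>" for x using assms(1) by (simp add: proper_fun_def)
  have ineq: "f (t *\<^sub>R x + (1 - t) *\<^sub>R y)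
      \<le> ereal (t * real_of_ereal (f x) + (1 - t) * real_of_ereal (f y))"
    if "0 < t" "t < 1" "f x \<noteq> \<infinity>" "f y \<noteq> \<infinity>" for t x y
  proof -
    have "f (t *\<^sub>R x + (1 - t) *\<^sub>R y) \<le> ereal t * f x + ereal (1 - t) * f y"
      using assms(2) that by (simp add: convex_fun_def)
    then show ?thesis
      using that minf by (cases "f x"; cases "f y") auto
  qed
  have conv: "convex {x. f x \<noteq> \<infinity>}"
    unfolding convex_alt
  proof (intro ballI allI impI)
    fix x y :: "real ^ 'n" and t :: real
    assume *: "x \<in> {x. f x \<noteq> \<infinity>}" "y \<in> {x. f x \<noteq> \<infinity>}" "0 \<le> t \<and> t \<le> 1"
    show "(1 - t) *\<^sub>R x + t *\<^sub>R y \<in> {x. f x \<noteq> \<infinity>}"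
    proof (cases "t = 0 \<or> t = 1")
      case False
      then show ?thesis
        using ineq[of "1 - t" x y] * by auto
    qed (use * in auto)
  qed
  show ?thesis
  proof (rule convex_onI)
    fix t :: real and x y assume *: "0 < t" "t < 1" "x \<in> {x. f x \<noteq> \<infinity>}" "y \<in> {x. f x \<noteq> \<infinity>}"
    then show "real_of_ereal (f ((1 - t) *\<^sub>R x + t *\<^sub>R y))
        \<le> (1 - t) * real_of_ereal (f x) + t * real_of_ereal (f y)"
      using ineq[of "1 - t" x y] minf[of "(1 - t) *\<^sub>R x + t *\<^sub>R y"]
      by (cases "f ((1 - t) *\<^sub>R x + t *\<^sub>R y)") auto
  qed (rule conv)
qed

text \<open>
  The weight differences are nonnegative and add up to \<open>weight p K\<close>, so the ergodic iterate is a
  convex combination of points of the effective domain and Jensen's inequality applies there.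
\<close>

lemma ergodic_iterate_jensen:
  fixes f :: "real ^ 'n \<Rightarrow> ereal"
  assumes "proper_fun f" "convex_fun f" "p > 0" "K \<ge> 1"
    and fin: "\<And>k. k \<in> {1..K} \<Longrightarrow> f (x k) = ereal (F k)"
  obtains Fb where "f (ergodic_iterate p x K) = ereal Fb"
    and "weight p K * Fb \<le> (\<Sum>k=1..K. weight_diff p k * F k)"
proof -
  let ?a = "\<lambda>k. weight_diff p k / weight p K"
  let ?X = "ergodic_iterate p x K"
  obtain K' where "K = Suc K'" using assms(4) by (cases K) auto
  then have W: "weight p K > 0" by (simp add: weight_Suc_pos)
  have X: "?X = (\<Sum>k=1..K. ?a k *\<^sub>R x k)"
    unfolding ergodic_iterate_def sum_weight_diff by (simp add: scaleR_sum_right)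
  have sum1: "(\<Sum>k=1..K. ?a k) = 1"
    using W sum_weight_diff[where ?K = K] by (simp add: sum_divide_distrib[symmetric])
  have nonneg: "?a k \<ge> 0" if "k \<in> {1..K}" for k
    using that W weight_le_weight_Suc[OF assms(3), of "k - 1"] by (simp add: weight_diff_def)
  note conv = convex_fun_real_of_ereal[OF assms(1,2)]
  have dom: "x k \<in> {x. f x \<noteq> \<infinity>}" if "k \<in> {1..K}" for k
    using fin[OF that] by simp
  have "?X \<in> {x. f x \<noteq> \<infinity>}"
    unfolding X using conv sum1 nonneg dom
    by (intro convex_sum) (auto simp: convex_on_def)
  then obtain Fb where Fb: "f ?X = ereal Fb"
    using assms(1) by (cases "f ?X") (auto simp: proper_fun_def)
  have "real_of_ereal (f ?X) \<le> (\<Sum>k=1..K. ?a k * real_of_ereal (f (x k)))"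
    unfolding X using assms(4) conv sum1 nonneg dom by (intro convex_on_sum) auto
  also have "\<dots> = (\<Sum>k=1..K. weight_diff p k * F k) / weight p K"
    by (simp add: fin sum_divide_distrib)
  finally show ?thesis
    using W Fb by (intro that[of Fb]) (simp_all add: field_simps)
qed

text \<open>
  Boundedness of the linear function \<open>y \<mapsto> lagrangian f A b xs y\<close> from above forces the residual at
  \<open>xs\<close> to vanish: it suffices to move from \<open>ys\<close> in the direction of the residual. The saddle value
  is then \<open>f xs\<close>.
\<close>

lemma saddle_point_lagrangian:
  fixes f :: "real ^ 'n \<Rightarrow> ereal"
  assumes "proper_fun f" "saddle_point (lagrangian f A b) xs ys"
  obtains fs where "f xs = ereal fs" "A *v xs = b"
    "\<And>x. ereal fs \<le> lagrangian f A b x ys"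
proof -
  have saddle: "lagrangian f A b xs y \<le> lagrangian f A b xs ys"
    "lagrangian f A b xs ys \<le> lagrangian f A b x ys" for x y
    using assms(2) by (auto simp: saddle_point_def)
  obtain x0 where "f x0 \<noteq> \<infinity>" using assms(1) by (auto simp: proper_fun_def)
  then have "f xs \<noteq> \<infinity>"
    using saddle(2)[of x0] by (auto simp: lagrangian_def)
  then obtain fs where fs: "f xs = ereal fs"
    using assms(1) by (cases "f xs") (auto simp: proper_fun_def)
  have "(A *v xs - b) \<bullet> y \<le> (A *v xs - b) \<bullet> ys" for y
    using saddle(1)[of y] by (simp add: lagrangian_def fs)
  from this[of "ys + (A *v xs - b)"] have "(A *v xs - b) \<bullet> (A *v xs - b) \<le> 0"
    by (simp add: inner_add_right)
  then have feas: "A *v xs = b"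
    by (meson antisym inner_ge_zero inner_eq_zero_iff right_minus_eq[THEN iffD1])
  show ?thesis
    using saddle(2) by (intro that[OF fs feas]) (simp add: lagrangian_def fs feas)
qed

lemma ergodic_iterate_residual:
  assumes "K \<ge> 1"
  shows "weight p K * ((A *v ergodic_iterate p x K - b) \<bullet> u)
       = (\<Sum>k=1..K. weight_diff p k * ((A *v x k - b) \<bullet> u))"
proof -
  obtain K' where "K = Suc K'" using assms by (cases K) auto
  then have W: "weight p K > 0" by (simp add: weight_Suc_pos)
  have "weight p K *\<^sub>R (A *v ergodic_iterate p x K) = (\<Sum>k=1..K. weight_diff p k *\<^sub>R (A *v x k))"
    using W unfolding ergodic_iterate_def sum_weight_diff
    by (simp add: matrix_vector_mult_scaleR linear_sum[OF matrix_vector_mul_linear])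
  moreover have "weight p K *\<^sub>R b = (\<Sum>k=1..K. weight_diff p k *\<^sub>R b)"
    by (simp only: scaleR_sum_left[symmetric] sum_weight_diff)
  ultimately have "weight p K *\<^sub>R (A *v ergodic_iterate p x K - b)
      = (\<Sum>k=1..K. weight_diff p k *\<^sub>R (A *v x k - b))"
    by (simp add: scaleR_diff_right sum_subtractf)
  from arg_cong[OF this, of "\<lambda>v. v \<bullet> u"] show ?thesis
    by (simp only: inner_scaleR_left inner_sum_left)
qed

section \<open>Convergence rate of the ergodic iterates\<close>

theorem theorem4p3:
  fixes f :: "real ^ 'n \<Rightarrow> ereal"
    and A :: "real ^ 'n ^ 'm"
    and b :: "real ^ 'm"
    and p r lam c :: real
    and xs :: "real ^ 'n" and ys :: "real ^ 'm"
    and x :: "nat \<Rightarrow> real ^ 'n" and y :: "nat \<Rightarrow> real ^ 'm"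
    and K :: nat
  assumes "proper_fun f" and "lsc_fun f" and "convex_fun f"
    and "p \<ge> 1" and "r = 2 \<or> r = p + 1"
    and "lam > 0" and "c \<ge> 0"
    and "strong_duality f A b"
    and "\<exists>x. primal_solution f A b x" and "\<exists>y. dual_solution f A b y"
    and "saddle_point (lagrangian f A b) xs ys"
    and "power_alm_avg_dual_update A b p r lam (\<lambda>k. weight p k / weight p (Suc k)) x y"
    and "\<And>k. lagrangian f A b (x (Suc k)) (y (Suc k))
            \<le> (INF z. lagrangian f A b z (y (Suc k))) + ereal (c / real (k + 1) powr (p + 1))"
    and "K \<ge> 1"
  shows "max (ereal (dual_norm (lr_norm r) (A *v ergodic_iterate p x K - b)))
             \<bar>f (ergodic_iterate p x K) - f xs\<bar>
         \<le> ereal ((c + (SUP v\<in>(\<lambda>u. (2 * lr_norm r ys + 1) *\<^sub>R u) ` {u. lr_norm r u \<le> 1}.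
                          epi_scale lam (power_fun p r) (y 0 - v)) * (p + 1) powr (p + 1))
                   / real K powr p)"
proof -
  have pos: "p > 0" "r > 0" using assms(4,5) by auto
  define d where "d = 2 * lr_norm r ys + 1"
  have d: "d \<ge> 0" by (simp add: d_def)
  let ?\<psi> = "epi_scale lam (power_fun p r)"
  define S where "S = (SUP v\<in>(\<lambda>u. d *\<^sub>R u) ` {u. lr_norm r u \<le> 1}. ?\<psi> (y 0 - v))"
  define R where "R = (c + S * (p + 1) powr (p + 1)) / real K powr p"
  let ?X = "ergodic_iterate p x K"
  obtain fs where fs: "f xs = ereal fs" "A *v xs = b" "\<And>x. ereal fs \<le> lagrangian f A b x ys"
    using saddle_point_lagrangian[OF assms(1,11)] by blast
  \<comment> \<open>The saddle point bounds the dual function above, and the termination criterion then makes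
    both the objective and the dual function finite at every iterate after the first.\<close>
  have "\<exists>F D. f (x (Suc k)) = ereal F \<and> dual_fun f A b (y (Suc k)) = ereal D" for k
  proof -
    have "dual_fun f A b (y (Suc k)) \<le> lagrangian f A b xs (y (Suc k))"
      unfolding dual_fun_def by (rule INF_lower) simp
    then have "dual_fun f A b (y (Suc k)) \<noteq> \<infinity>"
      by (auto simp: lagrangian_def fs)
    moreover have "f (x (Suc k)) \<noteq> - \<infinity>" using assms(1) by (simp add: proper_fun_def)
    ultimately show ?thesis
      using assms(13)[of k] unfolding dual_fun_def[symmetric]
      by (cases "f (x (Suc k))"; cases "dual_fun f A b (y (Suc k))") (auto simp: lagrangian_def)
  qed
  then obtain F' D' where F': "\<And>k. f (x (Suc k)) = ereal (F' k)"
    and D': "\<And>k. dual_fun f A b (y (Suc k)) = ereal (D' k)" by metis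
  \<comment> \<open>The shift aligns the indices with the iterates; the values at \<open>0\<close> are junk, and they enter
    only multiplied by \<open>weight p 0 = 0\<close>.\<close>
  define F D where "F k = F' (k - 1)" and "D k = D' (k - 1)" for k
  have F: "f (x (Suc k)) = ereal (F (Suc k))"
    and D: "dual_fun f A b (y (Suc k)) = ereal (D (Suc k))" for k
    by (simp_all add: F_def D_def F' D')
  define z where "z k = A *v x k - b" for k
  have dual: "D (Suc k) \<le> F (Suc j) + z (Suc j) \<bullet> y (Suc k)" for k j
  proof -
    have "dual_fun f A b (y (Suc k)) \<le> lagrangian f A b (x (Suc j)) (y (Suc k))"
      unfolding dual_fun_def by (rule INF_lower) simp
    then show ?thesis by (simp add: D F lagrangian_def z_def)
  qed
  obtain K' where K': "K = Suc K'" using assms(14) by (cases K) auto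
  have W: "weight p K > 0" by (simp add: K' weight_Suc_pos)
  \<comment> \<open>Weak duality at the feasible point \<open>xs\<close>.\<close>
  have "dual_fun f A b (y K) \<le> lagrangian f A b xs (y K)"
    unfolding dual_fun_def by (rule INF_lower) simp
  then have D_le: "D K \<le> fs"
    by (simp add: K' D lagrangian_def fs)
  obtain Fb where Fb: "f ?X = ereal Fb"
    "weight p K * Fb \<le> (\<Sum>k=1..K. weight_diff p k * F k)"
  proof (rule ergodic_iterate_jensen[OF assms(1,3) pos(1) assms(14)])
    show "f (x k) = ereal (F k)" if "k \<in> {1..K}" for k
      using that F[of "k - 1"] by simp
  qed
  have upper: "Fb - fs + d * ((A *v ?X - b) \<bullet> u) \<le> R" if u: "lr_norm r u \<le> 1" for u
  proof -
    have "(\<Sum>k=1..K. weight_diff p k * (F k + z k \<bullet> (d *\<^sub>R u)))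
       \<le> weight p K * D K + real K * (c + ?\<psi> (d *\<^sub>R u - y 0) * (p + 1) powr (p + 1))"
    proof (rule ergodic_potential_bound[OF assms(4-6)])
      show "y (Suc k) = averaged_point (\<lambda>k. weight p k / weight p (Suc k)) y k
        + lam *\<^sub>R gradient (convex_conjugate (power_fun p r)) (z (Suc k))" for k
        using assms(12) by (simp add: power_alm_avg_dual_update_def z_def)
      show "F (Suc k) + z (Suc k) \<bullet> y (Suc k) \<le> D (Suc k) + c / weight p (Suc k)" for k
        using assms(13)[of k] unfolding dual_fun_def[symmetric]
        by (simp add: D F lagrangian_def z_def weight_def add.commute)
    qed (rule dual)
    moreover have "weight p K * (Fb + (A *v ?X - b) \<bullet> (d *\<^sub>R u))
        \<le> (\<Sum>k=1..K. weight_diff p k * (F k + z k \<bullet> (d *\<^sub>R u)))"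
      using Fb(2) ergodic_iterate_residual[OF assms(14), of p A x b "d *\<^sub>R u"]
      unfolding z_def distrib_left sum.distrib by linarith
    moreover have "weight p K * D K \<le> weight p K * fs"
      using D_le W by simp
    moreover have "real K * (c + ?\<psi> (d *\<^sub>R u - y 0) * (p + 1) powr (p + 1)) \<le> weight p K * R"
    proof -
      have "?\<psi> (y 0 - d *\<^sub>R u) \<le> S"
        unfolding S_def using u
        by (intro cSUP_upper bdd_above_power_fun pos assms(6) d) auto
      then have "?\<psi> (d *\<^sub>R u - y 0) \<le> S"
        by (simp add: epi_scale_power_fun_minus_commute[OF pos(2)])
      then have "real K * (c + ?\<psi> (d *\<^sub>R u - y 0) * (p + 1) powr (p + 1))
          \<le> real K * (c + S * (p + 1) powr (p + 1))"
        by (intro mult_left_mono add_left_mono mult_right_mono) auto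
      also have "\<dots> = weight p K * R"
        using assms(14) by (simp add: R_def weight_def powr_add)
      finally show ?thesis .
    qed
    ultimately have "weight p K * (Fb - fs + d * ((A *v ?X - b) \<bullet> u)) \<le> weight p K * R"
      by (simp add: algebra_simps)
    then show ?thesis using W by simp
  qed
  have "0 \<le> Fb - fs + (A *v ?X - b) \<bullet> ys"
    using fs(3)[of ?X] by (simp add: lagrangian_def Fb(1))
  from residual_and_gap_bound[OF pos(2) this upper[unfolded d_def]]
  show ?thesis
    by (simp add: Fb(1) fs(1) R_def S_def d_def)
qed

end
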